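(* Let $R$ be a commutative ring, let $V,W$ be free $R$-modules of rank two with fixed bases, let $\alpha,\gamma,\delta\in R$, and let $F:V\to W$ be an isomorphism. Let $x=\binom{r}{Fz}\in V\oplus W$ (with $r,z\in V$) be an admissible vector for $T_F$. Then $P=(r\;z)\in\operatorname{GL}_2(R)$ and $$G_{L_x}=F\,P\,C\,P^{-1},\qquad C=\begin{pmatrix}0&\gamma\\1&\delta-\alpha\end{pmatrix},$$ where linear maps are identified with their matrices in the fixed bases.
   Context: The operator $T_F\in\operatorname{End}_R(V\oplus W)$ is $$T_F=\begin{pmatrix}\alpha I_V&F^{-1}\\ \gamma F&\delta I_W\end{pmatrix}.$$ For $x\in V\oplus W$, $L_x:=\langle x,T_Fx\rangle_R\subseteq V\oplus W$ is the submodule generated by $x$ and $T_Fx$. Let $\pi_V,\pi_W$ be the projections of $V\oplus W$ onto $V$ and $W$. A submodule $L\subseteq V\oplus W$ is $V$-transverse if $\pi_V|_L:L\to V$ is an isomorphism; in that case its graph map is $G_L=\pi_W|_L\circ(\pi_V|_L)^{-1}:V\to W$, so $L=\{\binom{v}{G_Lv}:v\in V\}$. A vector $x$ is admissible if $L_x$ is $V$-transverse. Since $F$ is an isomorphism, every $x\in V\oplus W$ is uniquely $x=\binom{r}{Fz}$ with $r,z\in V$; $(r\;z)$ denotes the $2\times2$ matrix whose columns are the coordinate vectors of $r$ and $z$ in the fixed basis of $V$. *)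

theory Defs
  imports "HOL-Analysis.Analysis"
begin

text \<open>
  Modules are given by a scalar multiplication satisfying the library locale \<^locale>\<open>module\<close>,
  and the direct sum of V and W is the product type with scalar multiplication
  \<^const>\<open>module_prod.scale\<close>.
\<close>

definition is_basis :: "('a::comm_ring_1 \<Rightarrow> 'v::ab_group_add \<Rightarrow> 'v) \<Rightarrow> ('n \<Rightarrow> 'v) \<Rightarrow> bool"
  where "is_basis s b \<longleftrightarrow>
    inj b \<and> \<not> module.dependent s (range b) \<and> module.span s (range b) = UNIV"

definition coord_vec ::
    "('a::comm_ring_1 \<Rightarrow> 'v::ab_group_add \<Rightarrow> 'v) \<Rightarrow> ('n::finite \<Rightarrow> 'v) \<Rightarrow> 'v \<Rightarrow> 'a ^ 'n"
  where "coord_vec s b v = (\<chi> i. module.representation s (range b) v (b i))"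

definition matrix_wrt ::
    "('a::comm_ring_1 \<Rightarrow> 'v::ab_group_add \<Rightarrow> 'v) \<Rightarrow> ('n::finite \<Rightarrow> 'v) \<Rightarrow>
     ('a \<Rightarrow> 'w::ab_group_add \<Rightarrow> 'w) \<Rightarrow> ('m::finite \<Rightarrow> 'w) \<Rightarrow> ('v \<Rightarrow> 'w) \<Rightarrow> 'a ^ 'n ^ 'm"
  where "matrix_wrt sV bV sW bW f = (\<chi> i j. coord_vec sW bW (f (bV j)) $ i)"

definition column_matrix :: "'a::zero ^ 'm \<Rightarrow> 'a ^ 'm \<Rightarrow> 'a ^ 2 ^ 'm"
  where "column_matrix u v = transpose (vector [u, v])"

definition T_op ::
    "('a::comm_ring_1 \<Rightarrow> 'v::ab_group_add \<Rightarrow> 'v) \<Rightarrow> ('a \<Rightarrow> 'w::ab_group_add \<Rightarrow> 'w) \<Rightarrow>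
     'a \<Rightarrow> 'a \<Rightarrow> 'a \<Rightarrow> ('v \<Rightarrow> 'w) \<Rightarrow> 'v \<times> 'w \<Rightarrow> 'v \<times> 'w"
  where "T_op sV sW \<alpha> \<gamma> \<delta> F x =
    (sV \<alpha> (fst x) + inv F (snd x), sW \<gamma> (F (fst x)) + sW \<delta> (snd x))"

definition cyclic_sub ::
    "('a::comm_ring_1 \<Rightarrow> 'v::ab_group_add \<Rightarrow> 'v) \<Rightarrow> ('a \<Rightarrow> 'w::ab_group_add \<Rightarrow> 'w) \<Rightarrow>
     ('v \<times> 'w \<Rightarrow> 'v \<times> 'w) \<Rightarrow> 'v \<times> 'w \<Rightarrow> ('v \<times> 'w) set"
  where "cyclic_sub sV sW T x = module.span (module_prod.scale sV sW) {x, T x}"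

text \<open>
  The projection \<^const>\<open>fst\<close> is linear (\<open>module_prod.module_hom_fst\<close>), so its restriction
  to a submodule is an isomorphism onto V precisely when it is bijective.
\<close>

definition V_transverse ::
    "('a::comm_ring_1 \<Rightarrow> 'v::ab_group_add \<Rightarrow> 'v) \<Rightarrow> ('a \<Rightarrow> 'w::ab_group_add \<Rightarrow> 'w) \<Rightarrow>
     ('v \<times> 'w) set \<Rightarrow> bool"
  where "V_transverse sV sW L \<longleftrightarrow>
    module.subspace (module_prod.scale sV sW) L \<and> bij_betw fst L UNIV"

definition graph_map :: "('v \<times> 'w) set \<Rightarrow> 'v \<Rightarrow> 'w"
  where "graph_map L = snd \<circ> inv_into L fst"

definition admissible ::
    "('a::comm_ring_1 \<Rightarrow> 'v::ab_group_add \<Rightarrow> 'v) \<Rightarrow> ('a \<Rightarrow> 'w::ab_group_add \<Rightarrow> 'w) \<Rightarrow>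
     ('v \<times> 'w \<Rightarrow> 'v \<times> 'w) \<Rightarrow> 'v \<times> 'w \<Rightarrow> bool"
  where "admissible sV sW T x \<longleftrightarrow> V_transverse sV sW (cyclic_sub sV sW T x)"

lemma graph_map_iff:
  assumes "bij_betw fst L UNIV"
  shows "(v, w) \<in> L \<longleftrightarrow> w = graph_map L v"
proof -
  have inj: "inj_on fst L" and im: "v \<in> fst ` L"
    using assms by (auto simp: bij_betw_def)
  have "inv_into L fst v \<in> L" "fst (inv_into L fst v) = v"
    using im by (auto intro: inv_into_into f_inv_into_f)
  then have "(v, graph_map L v) \<in> L"
    by (metis comp_apply graph_map_def prod.collapse)
  then show ?thesis
    using inj by (metis fst_conv inj_onD prod.inject)
qed

text \<open>
  The graph map of a transverse submodule is linear, hence it is determined by its matrix.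
\<close>

lemma module_hom_graph_map:
  assumes "module sV" and "module sW" and "V_transverse sV sW L"
  shows "module_hom sV sW (graph_map L)"
proof -
  interpret module_pair sV sW using assms by (simp add: module_pair_def)
  interpret module_prod sV sW by unfold_locales
  have sub: "p.subspace L" and bij: "bij_betw fst L UNIV"
    using assms(3) by (auto simp: V_transverse_def)
  have mem: "(v, graph_map L v) \<in> L" for v
    by (simp add: graph_map_iff[OF bij])
  show ?thesis
  proof unfold_locales
    fix a u v
    show "graph_map L (u + v) = graph_map L u + graph_map L v"
      using p.subspace_add[OF sub mem mem, of u v] by (simp add: graph_map_iff[OF bij])
    show "graph_map L (sV a v) = sW a (graph_map L v)"
      using p.subspace_scale[OF sub mem, of a v] by (simp add: scale_prod graph_map_iff[OF bij])
  qed
qed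

end

theory Submission
  imports Defs
begin

text \<open>
  Write \<open>L\<close> for the submodule generated by \<open>x = (r, F z)\<close> and
  \<open>T x = (\<alpha> r + z, \<gamma> F r + \<delta> F z)\<close>. Projecting \<open>L\<close> to \<open>V\<close> gives the span of \<open>r\<close> and
  \<open>\<alpha> r + z\<close>, which is the span of \<open>r\<close> and \<open>z\<close>. Transversality makes this projection onto, so
  \<open>r\<close> and \<open>z\<close> generate \<open>V\<close>; equivalently \<open>P\<close> has a right inverse, and a square matrix over a
  commutative ring with a right inverse has a unit determinant and hence is invertible
  (\<open>invertible_column_matrix_if_generating\<close>).

  The two generators lie on the graph of \<open>G\<close>, so \<open>G r = F z\<close> and
  \<open>G (\<alpha> r + z) = \<gamma> F r + \<delta> F z\<close>. By linearity \<open>G z = \<gamma> F r + (\<delta> - \<alpha>) F z\<close>. Thus \<open>C\<close> is the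
  matrix of \<open>F\<^sup>-\<^sup>1 G\<close> relative to \<open>(r, z)\<close>. In coordinates the two equations for the columns
  read \<open>G P = F P C\<close>, and multiplying by the inverse of \<open>P\<close> gives the formula.
\<close>

lemma coord_vec_add:
  assumes "module s" and "is_basis s b"
  shows "coord_vec s b (u + v) = coord_vec s b u + coord_vec s b v"
proof -
  interpret module s by fact
  show ?thesis
    using assms(2) by (simp add: coord_vec_def is_basis_def vec_eq_iff representation_add)
qed

lemma coord_vec_scale:
  assumes "module s" and "is_basis s b"
  shows "coord_vec s b (s a v) = a *s coord_vec s b v"
proof -
  interpret module s by fact
  show ?thesis
    using assms(2) by (simp add: coord_vec_def is_basis_def vec_eq_iff representation_scale)
qed

lemma coord_vec_sum:
  assumes "module s" and "is_basis s b"
  shows "coord_vec s b (sum f I) = (\<Sum>i\<in>I. coord_vec s b (f i))"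
proof -
  interpret module s by fact
  show ?thesis
    using assms(2) by (simp add: coord_vec_def is_basis_def vec_eq_iff representation_sum)
qed

lemma coord_vec_basis:
  assumes "module s" and "is_basis s b"
  shows "coord_vec s b (b j) = axis j 1"
proof -
  interpret module s by fact
  show ?thesis
    using assms(2)
    by (auto simp: coord_vec_def is_basis_def vec_eq_iff representation_basis axis_def inj_def)
qed

lemma sum_coord_vec_basis:
  assumes "module s" and "is_basis s b"
  shows "(\<Sum>j\<in>UNIV. s (coord_vec s b v $ j) (b j)) = v"
proof -
  interpret module s by fact
  have "inj b" and ind: "independent (range b)" and spn: "v \<in> span (range b)"
    using assms(2) by (auto simp: is_basis_def)
  have "(\<Sum>j\<in>UNIV. s (coord_vec s b v $ j) (b j)) = (\<Sum>c\<in>range b. s (representation (range b) v c) c)"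
    using \<open>inj b\<close> by (simp add: coord_vec_def sum.reindex)
  also have "\<dots> = v"
    using ind spn by (intro sum_representation_eq) auto
  finally show ?thesis .
qed

lemma matrix_wrt_mult_coord_vec:
  assumes sV: "module sV" and bV: "is_basis sV bV" and sW: "module sW" and bW: "is_basis sW bW"
    and f: "module_hom sV sW f"
  shows "matrix_wrt sV bV sW bW f *v coord_vec sV bV v = coord_vec sW bW (f v)"
proof -
  interpret f: module_hom sV sW f by fact
  have "coord_vec sW bW (f v)
      = coord_vec sW bW (f (\<Sum>j\<in>UNIV. sV (coord_vec sV bV v $ j) (bV j)))"
    by (simp add: sum_coord_vec_basis[OF sV bV])
  also have "\<dots> = (\<Sum>j\<in>UNIV. coord_vec sV bV v $ j *s coord_vec sW bW (f (bV j)))"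
    by (simp add: f.sum f.scale coord_vec_sum[OF sW bW] coord_vec_scale[OF sW bW])
  also have "\<dots> = matrix_wrt sV bV sW bW f *v coord_vec sV bV v"
    by (simp add: vec_eq_iff matrix_wrt_def matrix_vector_mult_def mult.commute)
  finally show ?thesis ..
qed

lemma column_matrix_nth [simp]:
  "column_matrix u v $ i $ 1 = u $ i" "column_matrix u v $ i $ 2 = v $ i"
  by (simp_all add: column_matrix_def transpose_def)

lemma matrix_mult_column_matrix:
  "A ** column_matrix u v = column_matrix (A *v u) (A *v v)"
  by (simp add: vec_eq_iff forall_2 matrix_matrix_mult_def matrix_vector_mult_def)

text \<open>
  Over a commutative ring a unit determinant makes the adjugate, scaled by the inverse
  determinant, a two-sided inverse.
\<close>

lemma invertible_if_det_unit_2: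
  fixes A :: "'a::comm_ring_1 ^ 2 ^ 2"
  assumes "det A * e = 1"
  shows "invertible A"
proof -
  define B :: "'a ^ 2 ^ 2" where
    "B = vector [vector [e * A $ 2 $ 2, - (e * A $ 1 $ 2)],
                 vector [- (e * A $ 2 $ 1), e * A $ 1 $ 1]]"
  have "e * (A $ 1 $ 1 * A $ 2 $ 2) - e * (A $ 1 $ 2 * A $ 2 $ 1) = 1"
    using assms by (simp add: det_2 algebra_simps)
  then have "A ** B = mat 1" and "B ** A = mat 1"
    by (simp_all add: B_def vec_eq_iff forall_2 matrix_matrix_mult_def sum_2 mat_def
        algebra_simps)
  then show ?thesis
    by (auto simp: invertible_def)
qed

lemma matrix_inv_right_inverse:
  assumes "invertible A"
  shows "A ** matrix_inv A = mat 1"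
  using assms unfolding invertible_def matrix_inv_def by (rule someI2_ex) blast

text \<open>
  The coefficients that express the basis vectors in terms of \<open>r\<close> and \<open>z\<close> are the columns of a
  right inverse \<open>Q\<close>. Multiplicativity of the determinant then shows that \<open>det Q\<close> is an inverse
  of the determinant in question.
\<close>

lemma invertible_column_matrix_if_generating:
  fixes s :: "'a::comm_ring_1 \<Rightarrow> 'v::ab_group_add \<Rightarrow> 'v" and b :: "2 \<Rightarrow> 'v"
  assumes s: "module s" and b: "is_basis s b"
    and gen: "\<And>v. \<exists>p q. v = s p r + s q z"
  shows "invertible (column_matrix (coord_vec s b r) (coord_vec s b z))" (is "invertible ?P")
proof -
  have "\<forall>j. \<exists>p q. b j = s p r + s q z"
    using gen by blast
  then obtain p q where pq: "b j = s (p j) r + s (q j) z" for j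
    unfolding choice_iff by blast
  define Q :: "'a ^ 2 ^ 2" where "Q = vector [\<chi> j. p j, \<chi> j. q j]"
  have "(?P ** Q) $ i $ j = coord_vec s b (b j) $ i" for i j
    by (simp add: pq[of j] Q_def matrix_matrix_mult_def sum_2 coord_vec_add[OF s b]
        coord_vec_scale[OF s b] mult.commute)
  then have "?P ** Q = mat 1"
    by (simp add: vec_eq_iff coord_vec_basis[OF s b] mat_def axis_def)
  then have "det ?P * det Q = 1"
    by (metis det_mul det_I)
  then show ?thesis
    by (rule invertible_if_det_unit_2)
qed

theorem theorem5p3:
  fixes sV :: "'a::comm_ring_1 \<Rightarrow> 'v::ab_group_add \<Rightarrow> 'v"
    and sW :: "'a \<Rightarrow> 'w::ab_group_add \<Rightarrow> 'w"
    and bV :: "2 \<Rightarrow> 'v" and bW :: "2 \<Rightarrow> 'w"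
    and \<alpha> \<gamma> \<delta> :: 'a
    and F :: "'v \<Rightarrow> 'w"
    and r z :: 'v
    and x :: "'v \<times> 'w"
    and P C :: "'a ^ 2 ^ 2"
  assumes "module sV" and "module sW"
    and "is_basis sV bV" and "is_basis sW bW"
    and "module_hom sV sW F" and "bij F"
    and "x = (r, F z)"
    and "admissible sV sW (T_op sV sW \<alpha> \<gamma> \<delta> F) x"
  defines "P \<equiv> column_matrix (coord_vec sV bV r) (coord_vec sV bV z)"
    and "C \<equiv> vector [vector [0, \<gamma>], vector [1, \<delta> - \<alpha>]]"
  shows "invertible P \<and>
    matrix_wrt sV bV sW bW (graph_map (cyclic_sub sV sW (T_op sV sW \<alpha> \<gamma> \<delta> F) x)) =
      matrix_wrt sV bV sW bW F ** P ** C ** matrix_inv P"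
proof -
  note sV = \<open>module sV\<close> and sW = \<open>module sW\<close>
  note bV = \<open>is_basis sV bV\<close> and bW = \<open>is_basis sW bW\<close>
  note F = \<open>module_hom sV sW F\<close>
  let ?T = "T_op sV sW \<alpha> \<gamma> \<delta> F"
  let ?L = "cyclic_sub sV sW ?T x"
  let ?G = "graph_map ?L"
  interpret module_pair sV sW using sV sW by (simp add: module_pair_def)
  interpret module_prod sV sW by unfold_locales
  have Tx: "?T (r, F z) = (sV \<alpha> r + z, sW \<gamma> (F r) + sW \<delta> (F z))"
    using \<open>bij F\<close> by (simp add: T_op_def bij_is_inj)
  have trans: "V_transverse sV sW ?L"
    using \<open>admissible sV sW ?T x\<close> by (simp add: admissible_def)
  then have bij: "bij_betw fst ?L UNIV"
    by (simp add: V_transverse_def)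
  interpret G: module_hom sV sW ?G
    using sV sW trans by (rule module_hom_graph_map)

  have "\<exists>p q. v = sV p r + sV q z" for v
  proof -
    obtain y where "y \<in> ?L" and y: "fst y = v"
      using bij by (metis UNIV_I bij_betw_def imageE)
    then obtain k l where "y = scale k x + scale l (?T x)"
      unfolding cyclic_sub_def p.span_insert p.span_singleton
      by (auto simp: algebra_simps)
    then have "v = sV k r + sV l (sV \<alpha> r + z)"
      using y by (auto simp: scale_prod \<open>x = (r, F z)\<close> Tx)
    then have "v = sV (k + l * \<alpha>) r + sV l z"
      by (simp add: m1.scale_right_distrib m1.scale_left_distrib add.assoc)
    then show ?thesis by blast
  qed
  then have inv: "invertible P"
    unfolding P_def by (rule invertible_column_matrix_if_generating[OF sV bV])

  have "x \<in> ?L" and "?T x \<in> ?L"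
    by (auto simp: cyclic_sub_def intro: p.span_base)
  then have Gr: "?G r = F z" and GT: "?G (sV \<alpha> r + z) = sW \<gamma> (F r) + sW \<delta> (F z)"
    unfolding \<open>x = (r, F z)\<close> Tx graph_map_iff[OF bij[unfolded \<open>x = (r, F z)\<close>]] by simp_all
  have Gz: "?G z = sW \<gamma> (F r) + sW (\<delta> - \<alpha>) (F z)"
    using GT by (simp add: G.add G.scale Gr m2.scale_left_diff_distrib algebra_simps)

  let ?MG = "matrix_wrt sV bV sW bW ?G" and ?MF = "matrix_wrt sV bV sW bW F"
  let ?c = "coord_vec sW bW"
  have "?MG ** P = column_matrix (?c (?G r)) (?c (?G z))"
    unfolding P_def matrix_mult_column_matrix
    by (simp add: matrix_wrt_mult_coord_vec[OF sV bV sW bW G.module_hom_axioms])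
  also have "\<dots> = column_matrix (?c (F r)) (?c (F z)) ** C"
    by (simp add: Gr Gz C_def vec_eq_iff forall_2 matrix_matrix_mult_def sum_2
        coord_vec_add[OF sW bW] coord_vec_scale[OF sW bW] mult.commute left_diff_distrib)
  also have "\<dots> = ?MF ** P ** C"
    unfolding P_def matrix_mult_column_matrix
    by (simp add: matrix_wrt_mult_coord_vec[OF sV bV sW bW F])
  finally have "?MG ** P ** matrix_inv P = ?MF ** P ** C ** matrix_inv P"
    by simp
  then have "?MG = ?MF ** P ** C ** matrix_inv P"
    by (simp add: matrix_mul_assoc[symmetric] matrix_inv_right_inverse[OF inv])
  with inv show ?thesis by blast
qed

end
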